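(* Let $\mathcal{F}$ be a forbidden family and let $k,d\in\mathbb{N}$. Let $G_1,G_2,\dots,G_d$ be graphs, each with $\mathcal{F}$-free chromatic span $\Lambda(G_i,\mathcal{F})\leq k$ (which is implied if $\chi(G_i,\mathcal{F})\leq k+1$). Let $S=\{s_1,s_2,\dots,s_d\}$ be a $k$-multiplicative Sidon set with $d$ (distinct) elements. Then $$\Lambda(G_1\,\square\,G_2\,\square\cdots\square\,G_d,\mathcal{F})\leq k\cdot\max S.$$
   Context: All graphs are finite, simple, undirected (with non-empty vertex set). $\mathbb{N}=\{1,2,\dots\}$ and $[k]=\{1,\dots,k\}$. A set $A\subseteq\mathbb{N}$ is $k$-multiplicative Sidon if for all $x,y\in A$ and all $a,b\in[k]$, $ax=by$ implies $a=b$ and $x=y$. A colouring of a graph $G$ is a function $c:V(G)\to\mathbb{Z}$ with $c(v)\neq c(w)$ for every edge $vw\in E(G)$; it is a $k$-colouring if it takes at most $k$ distinct values. The span of $c$ is $\max\{|c(v)-c(w)|:vw\in E(G)\}$ (taken to be $0$ if $G$ has no edges). A forbidden family $\mathcal{F}$ is a family of connected bipartite graphs, each with at least three vertices. A colouring $c$ of $G$ is $\mathcal{F}$-free if $|\{c(v):v\in V(H)\}|\geq 3$ for every (not necessarily induced) subgraph $H$ of $G$ that is isomorphic to a graph in $\mathcal{F}$. The $\mathcal{F}$-free chromatic number $\chi(G,\mathcal{F})$ is the minimum integer $k$ such that $G$ has an $\mathcal{F}$-free $k$-colouring. The $\mathcal{F}$-free chromatic span $\Lambda(G,\mathcal{F})$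 is the minimum integer $k$ such that $G$ has an $\mathcal{F}$-free colouring with span $k$. The cartesian product $G_1\,\square\,G_2\,\square\cdots\square\,G_d$ has vertex set $V(G_1)\times\cdots\times V(G_d)$, where $(v_1,\dots,v_d)$ and $(w_1,\dots,w_d)$ are adjacent if and only if $v_iw_i\in E(G_i)$ for some $i$ and $v_j=w_j$ for all $j\neq i$. *)

theory Defs
  imports "Graph_Theory.Graph_Theory" "HOL-Library.FuncSet"
begin

text \<open>
  Undirected simple graphs are the symmetric loop-free pair digraphs of
  \<^locale>\<open>pair_graph\<close>: an edge \<open>vw\<close> is represented by the two arcs
  \<open>(v, w)\<close> and \<open>(w, v)\<close>. The record coercion \<^const>\<open>with_proj\<close> makes the notions
  \<^const>\<open>subgraph\<close>, \<^const>\<open>digraph_iso\<close> and \<^const>\<open>Digraph_Component.connected\<close>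
  available for them; on these graphs they are the usual undirected notions.
\<close>

definition simple_graph :: "'a pair_pre_digraph \<Rightarrow> bool" where
  "simple_graph G \<longleftrightarrow> pair_graph G \<and> pverts G \<noteq> {}"

definition bipartite :: "'a pair_pre_digraph \<Rightarrow> bool" where
  "bipartite G \<longleftrightarrow>
     (\<exists>U W. pverts G = U \<union> W \<and> U \<inter> W = {} \<and> parcs G \<subseteq> U \<times> W \<union> W \<times> U)"

definition forbidden_family :: "'b pair_pre_digraph set \<Rightarrow> bool" where
  "forbidden_family F \<longleftrightarrow>
     (\<forall>X\<in>F. simple_graph X \<and> Digraph_Component.connected (with_proj X) \<and> bipartite X
        \<and> 3 \<le> card (pverts X))"

text \<open>Colourings are total functions, of which only the values on the vertices matter.\<close>

definition colouring :: "'a pair_pre_digraph \<Rightarrow> ('a \<Rightarrow> int) \<Rightarrow> bool" where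
  "colouring G c \<longleftrightarrow> (\<forall>(v, w)\<in>parcs G. c v \<noteq> c w)"

definition k_colouring :: "nat \<Rightarrow> 'a pair_pre_digraph \<Rightarrow> ('a \<Rightarrow> int) \<Rightarrow> bool" where
  "k_colouring k G c \<longleftrightarrow> colouring G c \<and> card (c ` pverts G) \<le> k"

definition colouring_span :: "'a pair_pre_digraph \<Rightarrow> ('a \<Rightarrow> int) \<Rightarrow> nat" where
  "colouring_span G c =
     (if parcs G = {} then 0 else Max ((\<lambda>(v, w). nat \<bar>c v - c w\<bar>) ` parcs G))"

definition family_free ::
    "'b pair_pre_digraph set \<Rightarrow> 'a pair_pre_digraph \<Rightarrow> ('a \<Rightarrow> int) \<Rightarrow> bool" where
  "family_free F G c \<longleftrightarrow>
     (\<forall>H :: 'a pair_pre_digraph.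
        simple_graph H \<and> subgraph (with_proj H) (with_proj G)
        \<and> (\<exists>X\<in>F. digraph_iso (with_proj X) (with_proj H))
        \<longrightarrow> 3 \<le> card (c ` pverts H))"

text \<open>
  Both minima are attained whenever \<open>F\<close> is a forbidden family and \<open>G\<close> is a simple graph:
  an injective colouring is \<open>F\<close>-free, since members of \<open>F\<close> have at least three vertices.
\<close>

definition free_chromatic_number ::
    "'a pair_pre_digraph \<Rightarrow> 'b pair_pre_digraph set \<Rightarrow> nat" where
  "free_chromatic_number G F = (LEAST k. \<exists>c. k_colouring k G c \<and> family_free F G c)"

definition free_chromatic_span ::
    "'a pair_pre_digraph \<Rightarrow> 'b pair_pre_digraph set \<Rightarrow> nat" where
  "free_chromatic_span G F =
     (LEAST k. \<exists>c. colouring G c \<and> family_free F G c \<and> colouring_span G c = k)"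

definition cartesian_product ::
    "'i set \<Rightarrow> ('i \<Rightarrow> 'a pair_pre_digraph) \<Rightarrow> ('i \<Rightarrow> 'a) pair_pre_digraph" where
  "cartesian_product I G =
     (let V = (\<Pi>\<^sub>E i\<in>I. pverts (G i)) in
      \<lparr>pverts = V,
       parcs = {(v, w). v \<in> V \<and> w \<in> V \<and>
          (\<exists>i\<in>I. (v i, w i) \<in> parcs (G i) \<and> (\<forall>j\<in>I - {i}. v j = w j))}\<rparr>)"

definition multiplicative_sidon :: "nat \<Rightarrow> nat set \<Rightarrow> bool" where
  "multiplicative_sidon k A \<longleftrightarrow>
     A \<subseteq> {1..} \<and>
     (\<forall>x\<in>A. \<forall>y\<in>A. \<forall>a\<in>{1..k}. \<forall>b\<in>{1..k}. a * x = b * y \<longrightarrow> a = b \<and> x = y)"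

end

theory Submission
  imports Defs
begin

text \<open>
  Choose optimal colourings \<open>c\<^sub>i\<close> of the factors and colour \<open>v\<close> by \<open>\<Sum>i. s\<^sub>i * c\<^sub>i (v\<^sub>i)\<close>. An edge in
  direction \<open>i\<close> then has colour difference \<open>s\<^sub>i * a\<close> with \<open>1 \<le> a \<le> k\<close>, so the Sidon property
  reads the direction off the colour difference. All edges of a subgraph with only two colours
  have the same colour difference, hence the same direction; if the subgraph is connected it lies
  in a single fibre, where the colouring is an injective affine image of one \<open>c\<^sub>i\<close>.
\<close>

section \<open>Simple graphs and subgraphs as conditions on vertex and arc sets\<close>

lemma simple_graph_iff:
  "simple_graph G \<longleftrightarrow> finite (pverts G) \<and> pverts G \<noteq> {} \<and> parcs G \<subseteq> pverts G \<times> pverts G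
     \<and> sym (parcs G) \<and> irrefl (parcs G)" (is "_ \<longleftrightarrow> ?R")
proof
  assume "simple_graph G"
  then have ne: "pverts G \<noteq> {}" and "pair_graph G"
    by (auto simp: simple_graph_def)
  then interpret pair_graph G by simp
  show ?R
    using ne no_loops' pair_sym_arcs
    by (auto simp: irrefl_def pair_finite_verts symmetric_def dest: in_arcsD1 in_arcsD2)
next
  assume R: ?R
  then have "finite (parcs G)"
    by (meson finite_SigmaI finite_subset)
  with R show "simple_graph G"
    unfolding simple_graph_def
    by (intro conjI) (unfold_locales, auto simp: symmetric_def irrefl_def)
qed

lemma simple_graph_finite_arcs: "simple_graph G \<Longrightarrow> finite (parcs G)"
  unfolding simple_graph_iff by (blast intro: finite_subset)

lemma simple_graph_wf: "simple_graph G \<Longrightarrow> wf_digraph (with_proj G)"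
  by (auto simp: simple_graph_iff wf_digraph_def)

lemma subgraph_with_proj_iff:
  "subgraph (with_proj H) (with_proj G) \<longleftrightarrow>
     pverts H \<subseteq> pverts G \<and> parcs H \<subseteq> parcs G \<and> wf_digraph (with_proj G) \<and> wf_digraph (with_proj H)"
  by (auto simp: subgraph_def)

section \<open>Images of graphs under maps injective on the vertices\<close>

definition map_pair_graph :: "('a \<Rightarrow> 'c) \<Rightarrow> 'a pair_pre_digraph \<Rightarrow> 'c pair_pre_digraph" where
  "map_pair_graph f H = \<lparr>pverts = f ` pverts H, parcs = map_prod f f ` parcs H\<rparr>"

lemma map_pair_graph_simps [simp]:
  "pverts (map_pair_graph f H) = f ` pverts H"
  "parcs (map_pair_graph f H) = map_prod f f ` parcs H"
  by (simp_all add: map_pair_graph_def)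

text \<open>Injectivity prevents an edge from collapsing to a loop.\<close>

lemma simple_graph_map_pair_graph:
  assumes "simple_graph H" and "inj_on f (pverts H)"
  shows "simple_graph (map_pair_graph f H)"
proof -
  have H: "finite (pverts H)" "pverts H \<noteq> {}" "parcs H \<subseteq> pverts H \<times> pverts H"
      "sym (parcs H)" "irrefl (parcs H)"
    using assms(1) by (auto simp: simple_graph_iff)
  have "sym (map_prod f f ` parcs H)"
    using H(4) by (auto intro!: symI dest: symD)
  moreover have "irrefl (map_prod f f ` parcs H)"
    using H(3,5) inj_onD[OF assms(2)] by (fastforce simp: irrefl_def)
  ultimately show ?thesis
    using H(1-3) by (auto simp: simple_graph_iff)
qed

text \<open>Used for coordinate projections: a copy of a forbidden graph inside a product becomes a
  copy inside one factor, over a different vertex type.\<close>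

lemma digraph_iso_map_pair_graph:
  assumes "simple_graph H" and "inj_on f (pverts H)"
  shows "digraph_iso (with_proj H) (with_proj (map_pair_graph f H))"
proof -
  \<comment> \<open>Arcs are pairs of vertices, so they are moved by \<open>map_prod f f\<close>,
    and the ends of an image arc are again its two components.\<close>
  let ?h = "\<lparr>iso_verts = f, iso_arcs = map_prod f f, iso_head = snd, iso_tail = fst\<rparr>"
  have "inj_on (map_prod f f) (parcs H)"
    using assms by (intro inj_on_subset[OF map_prod_inj_on]) (auto simp: simple_graph_iff)
  with assms have "pre_digraph.digraph_isomorphism (with_proj H) ?h"
    by (simp add: pre_digraph.digraph_isomorphism_def simple_graph_wf)
  moreover have "with_proj (map_pair_graph f H) = app_iso ?h (with_proj H)"
    by (simp add: app_iso_def with_proj_def)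
  ultimately show ?thesis
    by (auto simp: digraph_iso_def)
qed

section \<open>Copies of forbidden graphs, and connectivity\<close>

lemma iso_forbidden:
  assumes "forbidden_family F" "X \<in> F" "digraph_iso (with_proj X) (with_proj H)"
  shows "Digraph_Component.connected (with_proj H)" and "3 \<le> card (pverts H)"
proof -
  have X: "simple_graph X" "Digraph_Component.connected (with_proj X)" "3 \<le> card (pverts X)"
    using assms by (auto simp: forbidden_family_def)
  obtain h where h: "pre_digraph.digraph_isomorphism (with_proj X) h"
      and H: "with_proj H = app_iso h (with_proj X)"
    using assms(3) by (auto simp: digraph_iso_def)
  show "Digraph_Component.connected (with_proj H)"
    unfolding H using X h by (intro wf_digraph.connectedI_app_iso simple_graph_wf)
  have "pverts H = iso_verts h ` pverts X"
    using arg_cong[OF H, of verts] by simp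
  then show "3 \<le> card (pverts H)"
    using X pre_digraph.digraph_isomorphism_inj_on_verts[OF h] by (simp add: card_image)
qed

text \<open>Induction along a path in the symmetric closure of the arcs. It serves twice below: with
  the identity for \<open>g\<close> it shows that a connected graph without arcs has a single
  vertex, and with a coordinate for \<open>g\<close> it confines a subgraph to a fibre.\<close>

lemma connected_imp_constant:
  assumes "Digraph_Component.connected (with_proj H)"
    and "\<And>x y. (x, y) \<in> parcs H \<Longrightarrow> g x = g y"
    and "u \<in> pverts H" "v \<in> pverts H"
  shows "g u = g v"
proof -
  have "(u, v) \<in> rtrancl_on (pverts H) ((parcs H)\<^sup>s)"
    using assms by (simp add: connected_conv)
  then show ?thesis
    by induct (auto simp: symcl_def dest: assms(2))
qed

section \<open>Spans of colourings and attained minima\<close>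

lemma colouring_span_le_iff:
  assumes "finite (parcs G)"
  shows "colouring_span G c \<le> k \<longleftrightarrow> (\<forall>(v, w)\<in>parcs G. \<bar>c v - c w\<bar> \<le> int k)"
  using assms by (auto simp: colouring_span_def nat_le_iff)

lemma free_chromatic_span_le:
  assumes "colouring G c" "family_free F G c" "colouring_span G c \<le> k"
  shows "free_chromatic_span G F \<le> k"
  using assms unfolding free_chromatic_span_def by (intro order_trans[OF Least_le]) auto

text \<open>Supplies the witness that makes \<open>LEAST\<close> meaningful in both chromatic
  parameters.\<close>

lemma free_colouring_exists:
  fixes G :: "'a pair_pre_digraph"
  assumes "forbidden_family F" "simple_graph G"
  obtains c where "colouring G c" "family_free F G c"
proof -
  obtain c :: "'a \<Rightarrow> nat" where c: "inj_on c (pverts G)"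
    using assms(2) finite_imp_inj_to_nat_seg[of "pverts G"] by (auto simp: simple_graph_iff)
  define c' where "c' = int \<circ> c"
  have c': "inj_on c' (pverts G)"
    using c by (simp add: c'_def inj_on_def)
  have "colouring G c'"
    using assms(2) c' by (auto simp: colouring_def simple_graph_iff irrefl_def dest!: inj_onD)
  moreover have "family_free F G c'"
    unfolding family_free_def
  proof (intro allI impI, elim conjE bexE)
    fix H X
    assume "subgraph (with_proj H) (with_proj G)" "X \<in> F"
      and "digraph_iso (with_proj X) (with_proj H)"
    then have "pverts H \<subseteq> pverts G" and "3 \<le> card (pverts H)"
      using iso_forbidden(2)[OF assms(1)] by (auto simp: subgraph_with_proj_iff)
    then show "3 \<le> card (c' ` pverts H)"
      using inj_on_subset[OF c'] by (simp add: card_image)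
  qed
  ultimately show thesis by (rule that)
qed

lemma free_chromatic_span_attained:
  assumes "forbidden_family F" "simple_graph G"
  obtains c where "colouring G c" "family_free F G c" "colouring_span G c = free_chromatic_span G F"
proof -
  have "\<exists>k c. colouring G c \<and> family_free F G c \<and> colouring_span G c = k"
    using free_colouring_exists[OF assms] by metis
  from LeastI_ex[OF this] show thesis
    using that unfolding free_chromatic_span_def by blast
qed

lemma free_chromatic_number_attained:
  assumes "forbidden_family F" "simple_graph G"
  obtains c where "k_colouring (free_chromatic_number G F) G c" "family_free F G c"
proof -
  have "\<exists>k c. k_colouring k G c \<and> family_free F G c"
    using free_colouring_exists[OF assms] unfolding k_colouring_def by (metis order_refl)
  from LeastI_ex[OF this] show thesis
    using that unfolding free_chromatic_number_def by blast
qed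

text \<open>Being proper and \<open>F\<close>-free depends only on the partition into colour
  classes, so the colours of an optimal colouring may be renumbered injectively by consecutive
  integers from 0.\<close>

lemma free_chromatic_span_le_number:
  assumes "forbidden_family F" "simple_graph G" "free_chromatic_number G F \<le> k + 1"
  shows "free_chromatic_span G F \<le> k"
proof -
  obtain c where c: "k_colouring (free_chromatic_number G F) G c" "family_free F G c"
    using free_chromatic_number_attained[OF assms(1,2)] .
  let ?C = "c ` pverts G"
  have G: "finite (pverts G)" "parcs G \<subseteq> pverts G \<times> pverts G"
    using assms(2) by (auto simp: simple_graph_iff)
  obtain h where h: "bij_betw h ?C {0..<card ?C}"
    using G(1) ex_bij_betw_finite_nat by blast
  define c' where "c' = (\<lambda>v. int (h (c v)))"
  have inj: "inj_on (int \<circ> h) ?C"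
    using h by (auto simp: bij_betw_def inj_on_def)
  have "colouring G c'"
    unfolding colouring_def
  proof clarify
    fix v w
    assume "(v, w) \<in> parcs G" and "c' v = c' w"
    then have "c v = c w"
      using inj_onD[OF inj, of "c v" "c w"] G(2) by (auto simp: c'_def)
    then show False
      using c(1) \<open>(v, w) \<in> parcs G\<close> by (auto simp: k_colouring_def colouring_def)
  qed
  moreover have "family_free F G c'"
    unfolding family_free_def
  proof (intro allI impI)
    fix H
    assume H: "simple_graph H \<and> subgraph (with_proj H) (with_proj G)
      \<and> (\<exists>X\<in>F. digraph_iso (with_proj X) (with_proj H))"
    then have "c ` pverts H \<subseteq> ?C"
      by (auto simp: subgraph_with_proj_iff)
    then have "card ((int \<circ> h) ` c ` pverts H) = card (c ` pverts H)"
      by (intro card_image inj_on_subset[OF inj])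
    moreover have "(int \<circ> h) ` c ` pverts H = c' ` pverts H"
      by (auto simp: c'_def)
    ultimately show "3 \<le> card (c' ` pverts H)"
      using c(2) H by (auto simp: family_free_def)
  qed
  moreover have "colouring_span G c' \<le> k"
  proof -
    have "card ?C \<le> k + 1"
      using c(1) assms(3) by (simp add: k_colouring_def)
    \<comment> \<open>At most \<open>k + 1\<close> colours numbered from 0 have largest value at
      most \<open>k\<close>, so any two of them differ by at most \<open>k\<close>.\<close>
    then have "0 \<le> c' v \<and> c' v \<le> int k" if "v \<in> pverts G" for v
      using bij_betwE[OF h] that by (fastforce simp: c'_def)
    then have "\<bar>c' v - c' w\<bar> \<le> int k" if "(v, w) \<in> parcs G" for v w
      using that G(2) by (smt (verit) mem_Sigma_iff subsetD)
    then show ?thesis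
      using assms(2) by (auto simp: colouring_span_le_iff simple_graph_finite_arcs)
  qed
  ultimately show ?thesis
    by (rule free_chromatic_span_le)
qed

section \<open>Cartesian products and the arithmetic of colour differences\<close>

lemma pverts_cartesian_product [simp]:
  "pverts (cartesian_product I G) = (\<Pi>\<^sub>E i\<in>I. pverts (G i))"
  by (simp add: cartesian_product_def Let_def)

lemma parcs_cartesian_product_iff:
  "(v, w) \<in> parcs (cartesian_product I G) \<longleftrightarrow>
     v \<in> (\<Pi>\<^sub>E i\<in>I. pverts (G i)) \<and> w \<in> (\<Pi>\<^sub>E i\<in>I. pverts (G i)) \<and>
     (\<exists>i\<in>I. (v i, w i) \<in> parcs (G i) \<and> (\<forall>j\<in>I - {i}. v j = w j))"
  by (simp add: cartesian_product_def Let_def)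

lemma finite_parcs_cartesian_product:
  assumes "finite I" "\<And>i. i \<in> I \<Longrightarrow> finite (pverts (G i))"
  shows "finite (parcs (cartesian_product I G))"
proof (rule finite_subset)
  let ?V = "\<Pi>\<^sub>E i\<in>I. pverts (G i)"
  show "parcs (cartesian_product I G) \<subseteq> ?V \<times> ?V"
    by (auto simp: parcs_cartesian_product_iff)
  show "finite (?V \<times> ?V)"
    using assms by (simp add: finite_PiE)
qed

text \<open>All summands except the one at \<open>i\<close> cancel; this computes colour differences
  both along edges of the product and within a fibre.\<close>

lemma sum_diff_single_coordinate:
  fixes f :: "'i \<Rightarrow> 'a \<Rightarrow> 'b::ab_group_add"
  assumes "finite I" "i \<in> I" "\<forall>j\<in>I - {i}. v j = w j"
  shows "(\<Sum>j\<in>I. f j (v j)) - (\<Sum>j\<in>I. f j (w j)) = f i (v i) - f i (w i)"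
proof -
  have "(\<Sum>j\<in>I - {i}. f j (v j)) = (\<Sum>j\<in>I - {i}. f j (w j))"
    using assms(3) by simp
  then show ?thesis
    using assms(1,2) by (simp add: sum.remove[of I i])
qed

text \<open>Two distinct elements exhaust a set of at most two, so both pairs are the same unordered
  pair.\<close>

lemma abs_diff_eq_of_card_le_2:
  fixes C :: "int set"
  assumes "finite C" "card C \<le> 2" "{a, b, p, q} \<subseteq> C" "a \<noteq> b" "p \<noteq> q"
  shows "\<bar>a - b\<bar> = \<bar>p - q\<bar>"
proof -
  have "{a, b} = C" "{p, q} = C"
    using assms by (intro card_seteq; simp)+
  then show ?thesis
    by (metis abs_minus_commute doubleton_eq_iff)
qed

text \<open>The absolute values of the nonzero integers \<open>a\<close> and \<open>b\<close> lie in
  \<open>{1..k}\<close>, so the Sidon property applies to them; signs are irrelevant because an edge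
  may be read in either orientation.\<close>

lemma multiplicative_sidon_abs_diff:
  assumes "multiplicative_sidon k S" "x \<in> S" "y \<in> S"
    and "a \<noteq> 0" "\<bar>a\<bar> \<le> int k" "b \<noteq> 0" "\<bar>b\<bar> \<le> int k"
    and "\<bar>int x * a\<bar> = \<bar>int y * b\<bar>"
  shows "x = y"
proof -
  have "int (nat \<bar>a\<bar> * x) = int (nat \<bar>b\<bar> * y)"
    using assms(8) by (simp add: abs_mult mult.commute)
  then have "nat \<bar>a\<bar> * x = nat \<bar>b\<bar> * y"
    by (simp only: of_nat_eq_iff)
  moreover have "nat \<bar>a\<bar> \<in> {1..k}" "nat \<bar>b\<bar> \<in> {1..k}"
    using assms(4-7) by auto
  ultimately show ?thesis
    using assms(1-3) unfolding multiplicative_sidon_def by blast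
qed

section \<open>The span bound for products\<close>

lemma free_chromatic_span_cartesian_product_le:
  fixes G :: "'i \<Rightarrow> 'a pair_pre_digraph" and s :: "'i \<Rightarrow> nat"
  assumes F: "forbidden_family F" and I: "finite I"
    and simple: "\<And>i. i \<in> I \<Longrightarrow> simple_graph (G i)"
    and s: "inj_on s I" "multiplicative_sidon k (s ` I)"
    and span: "\<And>i. i \<in> I \<Longrightarrow> free_chromatic_span (G i) F \<le> k"
  shows "free_chromatic_span (cartesian_product I G) F \<le> k * Max (s ` I)"
proof -
  let ?P = "cartesian_product I G"
  have "\<exists>c. colouring (G i) c \<and> family_free F (G i) c \<and> colouring_span (G i) c \<le> k"
    if "i \<in> I" for i
    using free_chromatic_span_attained[OF F simple[OF that]] span[OF that] by metis
  then obtain c where c: "\<And>i. i \<in> I \<Longrightarrow> colouring (G i) (c i)"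
      "\<And>i. i \<in> I \<Longrightarrow> family_free F (G i) (c i)"
      "\<And>i. i \<in> I \<Longrightarrow> colouring_span (G i) (c i) \<le> k"
    by metis
  have edge: "c i x \<noteq> c i y" "\<bar>c i x - c i y\<bar> \<le> int k" if "i \<in> I" "(x, y) \<in> parcs (G i)" for i x y
    using c[OF that(1)] that(2) simple_graph_finite_arcs[OF simple[OF that(1)]]
    by (auto simp: colouring_def colouring_span_le_iff)
  have s_pos: "s i > 0" if "i \<in> I" for i
    using s(2) that by (auto simp: multiplicative_sidon_def)
  define C where "C v = (\<Sum>i\<in>I. int (s i) * c i (v i))" for v
  have C_diff: "C v - C w = int (s i) * (c i (v i) - c i (w i))"
    if "i \<in> I" "\<forall>j\<in>I - {i}. v j = w j" for v w i
    using sum_diff_single_coordinate[OF I that, where f = "\<lambda>i x. int (s i) * c i x"]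
    by (simp add: C_def right_diff_distrib)
  have "colouring ?P C"
    unfolding colouring_def
  proof clarify
    fix v w
    assume "(v, w) \<in> parcs ?P" and eq: "C v = C w"
    then obtain i where i: "i \<in> I" "(v i, w i) \<in> parcs (G i)" "\<forall>j\<in>I - {i}. v j = w j"
      by (auto simp: parcs_cartesian_product_iff)
    show False
      using C_diff[OF i(1,3)] eq edge(1)[OF i(1,2)] s_pos[OF i(1)] by simp
  qed
  moreover have "colouring_span ?P C \<le> k * Max (s ` I)"
  proof -
    have "\<bar>C v - C w\<bar> \<le> int (k * Max (s ` I))" if vw: "(v, w) \<in> parcs ?P" for v w
    proof -
      obtain i where i: "i \<in> I" "(v i, w i) \<in> parcs (G i)" "\<forall>j\<in>I - {i}. v j = w j"
        using vw unfolding parcs_cartesian_product_iff by blast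
      have "s i \<le> Max (s ` I)"
        using I i(1) by simp
      then have "int (s i) * \<bar>c i (v i) - c i (w i)\<bar> \<le> int (Max (s ` I)) * int k"
        using edge(2)[OF i(1,2)] by (intro mult_mono) auto
      then show ?thesis
        using C_diff[OF i(1,3)] by (simp add: abs_mult mult.commute)
    qed
    moreover have "finite (parcs ?P)"
      using I simple by (auto intro!: finite_parcs_cartesian_product simp: simple_graph_iff)
    ultimately show ?thesis
      by (auto simp: colouring_span_le_iff)
  qed
  moreover have "family_free F ?P C"
    unfolding family_free_def
  proof (intro allI impI, elim conjE bexE, rule ccontr)
    fix H X
    assume H: "simple_graph H" "subgraph (with_proj H) (with_proj ?P)"
      and X: "X \<in> F" "digraph_iso (with_proj X) (with_proj H)"
      and "\<not> 3 \<le> card (C ` pverts H)"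
    then have card: "card (C ` pverts H) \<le> 2" by simp
    have H': "finite (pverts H)" "pverts H \<noteq> {}" "parcs H \<subseteq> pverts H \<times> pverts H"
      using H(1) by (auto simp: simple_graph_iff)
    have sub: "pverts H \<subseteq> (\<Pi>\<^sub>E i\<in>I. pverts (G i))" "parcs H \<subseteq> parcs ?P"
      using H(2) by (auto simp: subgraph_with_proj_iff)
    note conn = iso_forbidden(1)[OF F X] and card3 = iso_forbidden(2)[OF F X]
    obtain v0 where v0: "v0 \<in> pverts H"
      using H'(2) by blast
    \<comment> \<open>Without arcs, connectivity would leave only the vertex \<open>v0\<close>, but
      a forbidden graph has at least three vertices.\<close>
    have "parcs H \<noteq> {}"
    proof
      assume "parcs H = {}"
      then have "v = v0" if "v \<in> pverts H" for v
        using connected_imp_constant[OF conn, of "\<lambda>v. v" v v0] that v0 by simp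
      then have "pverts H \<subseteq> {v0}" by blast
      then show False
        using card3 card_mono[of "{v0}" "pverts H"] by simp
    qed
    \<comment> \<open>The arc \<open>(p, q)\<close> is a reference: its direction \<open>i\<close>
      will turn out to be the direction of every arc of \<open>H\<close>.\<close>
    then obtain p q where pq: "(p, q) \<in> parcs H" by auto
    then obtain i where i: "i \<in> I" "(p i, q i) \<in> parcs (G i)" "\<forall>j\<in>I - {i}. p j = q j"
      using subsetD[OF sub(2) pq] unfolding parcs_cartesian_product_iff by blast
    have direction: "(v i, w i) \<in> parcs (G i) \<and> (\<forall>j\<in>I - {i}. v j = w j)"
      if vw: "(v, w) \<in> parcs H" for v w
    proof -
      obtain j where j: "j \<in> I" "(v j, w j) \<in> parcs (G j)" "\<forall>l\<in>I - {j}. v l = w l"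
        using subsetD[OF sub(2) vw] unfolding parcs_cartesian_product_iff by blast
      have "C v \<noteq> C w" "C p \<noteq> C q"
        using \<open>colouring ?P C\<close> sub(2) vw pq by (auto simp: colouring_def)
      then have "\<bar>C v - C w\<bar> = \<bar>C p - C q\<bar>"
        using H' vw pq card by (intro abs_diff_eq_of_card_le_2[of "C ` pverts H"]) auto
      \<comment> \<open>The multipliers are the colour differences in the factors: nonzero because
        the factor colourings are proper, and at most \<open>k\<close> in absolute value by the span
        bound.\<close>
      then have "s j = s i"
        using C_diff[OF i(1,3)] C_diff[OF j(1,3)] edge[OF i(1,2)] edge[OF j(1,2)] i(1) j(1)
        by (intro multiplicative_sidon_abs_diff[OF s(2),
              where a = "c j (v j) - c j (w j)" and b = "c i (p i) - c i (q i)"]) auto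
      then have "j = i"
        using s(1) i(1) j(1) by (simp add: inj_on_eq_iff)
      with j show ?thesis by simp
    qed
    \<comment> \<open>No arc of \<open>H\<close> changes a coordinate other than \<open>i\<close>,
      so by connectivity that coordinate is constant on \<open>H\<close>.\<close>
    have fibre: "v j = v0 j" if "v \<in> pverts H" "j \<in> I - {i}" for v j
      using connected_imp_constant[OF conn, of "\<lambda>v. v j" v v0] direction that v0 by blast
    have inj: "inj_on (\<lambda>v. v i) (pverts H)"
    proof (rule inj_onI)
      fix v w
      assume vw: "v \<in> pverts H" "w \<in> pverts H" "v i = w i"
      have "v j = w j" if "j \<in> I" for j
        using fibre[OF vw(1), of j] fibre[OF vw(2), of j] vw(3) that by (cases "j = i") auto
      then show "v = w"
        using sub(1) vw(1,2) by (intro PiE_ext[of v I "\<lambda>i. pverts (G i)" w]) auto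
    qed
    \<comment> \<open>The projection to coordinate \<open>i\<close> is injective on
      \<open>H\<close>, so \<open>?H\<close> is a copy of \<open>X\<close> in \<open>G i\<close> and
      sees at least three colours of \<open>c i\<close>.\<close>
    let ?H = "map_pair_graph (\<lambda>v. v i) H"
    have "simple_graph ?H"
      using H(1) inj by (rule simple_graph_map_pair_graph)
    moreover have "subgraph (with_proj ?H) (with_proj (G i))"
      using sub(1) i(1) direction simple_graph_wf[OF \<open>simple_graph ?H\<close>] simple_graph_wf[OF simple[OF i(1)]]
      by (auto simp: subgraph_with_proj_iff)
    moreover have "digraph_iso (with_proj X) (with_proj ?H)"
      using X(2) digraph_iso_map_pair_graph[OF H(1) inj] by (rule digraph_iso_trans)
    ultimately have "3 \<le> card (c i ` pverts ?H)"
      using c(2)[OF i(1)] X(1) unfolding family_free_def by blast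
    \<comment> \<open>On the fibre through \<open>v0\<close>, \<open>C\<close> is an affine function
      of \<open>c i\<close> with slope \<open>s i > 0\<close>. Such a map is injective, so
      \<open>H\<close> has as many colours as \<open>?H\<close>, contradicting the bound of
      two.\<close>
    moreover have "C ` pverts H = (\<lambda>x. C v0 + int (s i) * (x - c i (v0 i))) ` c i ` pverts ?H"
    proof -
      have "C v = C v0 + int (s i) * (c i (v i) - c i (v0 i))" if "v \<in> pverts H" for v
        using C_diff[OF i(1), of v v0] fibre[OF that] by simp
      then show ?thesis
        by (simp add: image_image)
    qed
    then have "card (C ` pverts H) = card (c i ` pverts ?H)"
      using s_pos[OF i(1)] by (simp add: card_image inj_on_def)
    ultimately show False
      using card by simp
  qed
  ultimately show ?thesis
    by (intro free_chromatic_span_le)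
qed

text \<open>The parenthetical remark on chromatic numbers forms the first conjunct. The map
  \<open>s\<close> enumerates \<open>S\<close>, and its injectivity encodes that the
  \<open>d\<close> elements are distinct.\<close>

theorem lemma2:
  fixes F :: "'b pair_pre_digraph set"
    and G :: "nat \<Rightarrow> 'a pair_pre_digraph"
    and k d :: nat
    and s :: "nat \<Rightarrow> nat"
    and S :: "nat set"
  assumes "forbidden_family F"
    and "k \<ge> 1" and "d \<ge> 1"
    and "\<forall>i\<in>{1..d}. simple_graph (G i)"
    and "S = s ` {1..d}" and "inj_on s {1..d}"
    and "multiplicative_sidon k S"
  shows "(\<forall>i\<in>{1..d}. free_chromatic_number (G i) F \<le> k + 1 \<longrightarrow> free_chromatic_span (G i) F \<le> k)
    \<and> ((\<forall>i\<in>{1..d}. free_chromatic_span (G i) F \<le> k) \<longrightarrow>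
         free_chromatic_span (cartesian_product {1..d} G) F \<le> k * Max S)"
proof (intro conjI ballI impI)
  show "free_chromatic_span (G i) F \<le> k"
    if "i \<in> {1..d}" "free_chromatic_number (G i) F \<le> k + 1" for i
    using free_chromatic_span_le_number[OF assms(1) _ that(2)] assms(4) that(1) by blast
  show "free_chromatic_span (cartesian_product {1..d} G) F \<le> k * Max S"
    if "\<forall>i\<in>{1..d}. free_chromatic_span (G i) F \<le> k"
    unfolding assms(5)
  proof (rule free_chromatic_span_cartesian_product_le[OF assms(1) finite_atLeastAtMost])
    show "multiplicative_sidon k (s ` {1..d})"
      using assms(5,7) by simp
  qed (use assms(4,6) that in blast)+
qed

end
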